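(* Let $d:\mathbb{R}\to\mathbb{R}$ be a convex function, let $\mu,\bar\sigma,t\in\mathbb{R}$, and let $\mathcal{P}_{(\mu,\bar\sigma)}$ be the set of probability distributions on $\mathbb{R}$ with $\mathbb{E}[X]=\mu$ and $\mathbb{E}[d(X)]=\bar\sigma$, where $(\mu,\bar\sigma)$ is in the interior of the set of pairs $(\mathbb{E}[X],\mathbb{E}[d(X)])$ attainable by probability distributions on $\mathbb{R}$. Suppose that there exists a solution $x_0^*\in(t,\infty)$ to the equation (in $x_0$) $$\frac{\bar\sigma t-\mu d(t)}{t\,d(x_0)-x_0\,d(t)}+\frac{\mu d(x_0)-\bar\sigma x_0}{t\,d(x_0)-x_0\,d(t)}=1,$$ such that the corresponding two-point distribution, with support $\{t,x_0^*\}$, is feasible. Then, for a real-valued random variable $X$ with distribution $\mathbb{P}\in\mathcal{P}_{(\mu,\bar\sigma)}$, it holds that $$\sup_{\mathbb{P}\in\mathcal{P}_{(\mu,\bar\sigma)}}\mathbb{E}_{\mathbb{P}}[X\mid X\ge t]=x_0^*.$$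
   Context: The conditional expectation is $\mathbb{E}_{\mathbb{P}}[X\mid X\ge t]=\mathbb{E}_{\mathbb{P}}[X\mathbf{1}_{\{X\ge t\}}]/\mathbb{P}(X\ge t)$, and the supremum is taken over those $\mathbb{P}$ in the set for which $\mathbb{P}(X\ge t)>0$. The supremum need not be attained. The two-point distribution corresponding to $x_0^*$ puts masses $p_t$ on $t$ and $p_{x_0^*}$ on $x_0^*$ determined by $p_t t+p_{x_0^*}x_0^*=\mu$ and $p_t d(t)+p_{x_0^*}d(x_0^* )=\bar\sigma$ (the equation expresses $p_t+p_{x_0^*}=1$, and its denominator is understood to be nonzero at $x_0^*$); it is feasible if it is a probability distribution, hence an element of $\mathcal{P}_{(\mu,\bar\sigma)}$. *)

theory Defs
  imports "HOL-Probability.Probability"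
begin

text \<open>Distributions under which both \<open>E[X]\<close> and \<open>E[d(X)]\<close> exist as finite numbers. Integrability is
  required explicitly because the Bochner integral of a non-integrable function is \<open>0\<close>.\<close>

definition finite_moment_distrs :: "(real \<Rightarrow> real) \<Rightarrow> real measure set" where
  "finite_moment_distrs d =
     {P. real_distribution P \<and> integrable P (\<lambda>x. x) \<and> integrable P d}"

definition attainable_moments :: "(real \<Rightarrow> real) \<Rightarrow> (real \<times> real) set" where
  "attainable_moments d =
     (\<lambda>P. (integral\<^sup>L P (\<lambda>x. x), integral\<^sup>L P d)) ` finite_moment_distrs d"

definition ambiguity_set :: "(real \<Rightarrow> real) \<Rightarrow> real \<Rightarrow> real \<Rightarrow> real measure set" where
  "ambiguity_set d \<mu> \<sigma> =
     {P \<in> finite_moment_distrs d. integral\<^sup>L P (\<lambda>x. x) = \<mu> \<and> integral\<^sup>L P d = \<sigma>}"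

text \<open>\<open>E[X | X \<ge> t]\<close> for \<open>X\<close> with distribution \<open>P\<close>; meaningful only when \<open>P(X \<ge> t) > 0\<close>.\<close>

definition cond_expectation_ge :: "real measure \<Rightarrow> real \<Rightarrow> real" where
  "cond_expectation_ge P t = integral\<^sup>L P (\<lambda>x. x * indicator {t..} x) / measure P {t..}"

text \<open>The two linear equations determine the masses when \<open>t * d x - x * d t \<noteq> 0\<close>. Feasibility,
  i.e. nonnegative masses with total \<open>1\<close>, is carried by the type \<^typ>\<open>real pmf\<close>. The inclusion does
  not presuppose that both masses are positive.\<close>

definition two_point_feasible :: "(real \<Rightarrow> real) \<Rightarrow> real \<Rightarrow> real \<Rightarrow> real \<Rightarrow> real \<Rightarrow> bool" where
  "two_point_feasible d \<mu> \<sigma> t x \<longleftrightarrow>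
     (\<exists>p :: real pmf. set_pmf p \<subseteq> {t, x} \<and>
        pmf p t * t + pmf p x * x = \<mu> \<and>
        pmf p t * d t + pmf p x * d x = \<sigma>)"

end

theory Submission
  imports Defs
begin

text \<open>
  Subtract from \<open>d\<close> the affine function \<open>x \<mapsto> \<alpha> + \<beta> * x\<close> through the points of its graph over \<open>t\<close>
  and \<open>x\<^sub>0\<close>. The difference \<open>h\<close> is convex and vanishes at \<open>t\<close> and \<open>x\<^sub>0\<close>. As the two-point
  distribution has moments \<open>(\<mu>, \<sigma>)\<close>, this point lies on the chord, so \<open>E[h(X)] = 0\<close> for every
  distribution in the ambiguity set. As the point is interior, it lies strictly above the graph of
  \<open>d\<close> (lemma \<open>interior_attainable_above_graph\<close>), that is, \<open>h \<mu> < 0\<close>; hence \<open>t < \<mu> < x\<^sub>0\<close>.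

  Upper bound, by duality: a subgradient \<open>s\<close> of \<open>h\<close> at \<open>x\<^sub>0\<close> is positive because \<open>h \<mu> < 0\<close>, and for
  the same reason \<open>h \<ge> 0\<close> to the left of \<open>t\<close>. Thus \<open>h / s\<close> dominates the function that is
  \<open>x - x\<^sub>0\<close> on \<open>{t..}\<close> and \<open>0\<close> elsewhere. Taking expectations gives
  \<open>E[(X - x\<^sub>0) 1{X \<ge> t}] \<le> 0\<close> (lemma \<open>cond_expectation_ge_le\<close>).

  Approximation: the two-point distribution on \<open>{t, x\<^sub>0}\<close> lies entirely in \<open>{t..}\<close>, so its
  conditional mean is only \<open>\<mu>\<close>. Moving the lower atom slightly to the left of \<open>t\<close> excludes it from
  the conditioning event. To keep both moments, the upper atom must move as well, to the second
  intersection of the graph with the line through the new lower atom and \<open>(\<mu>, \<sigma>)\<close>. By continuity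
  this intersection can be kept arbitrarily close to \<open>x\<^sub>0\<close> (lemma \<open>chord_through_nearby_point\<close>), and
  it is the conditional mean of the new distribution (lemma \<open>two_point_distribution\<close>).
\<close>

section \<open>Convex functions on the line\<close>

lemma convex_on_subgradient:
  fixes f :: "real \<Rightarrow> real"
  assumes "convex_on UNIV f"
  obtains s where "\<And>y. f x + s * (y - x) \<le> f y"
proof
  show "f x + Inf ((\<lambda>z. (f x - f z) / (x - z)) ` ({x<..} \<inter> UNIV)) * (y - x) \<le> f y" for y
    using convex_le_Inf_differential[OF assms, of x y] by simp
qed

text \<open>Convexity without division, so that signs of \<open>f\<close> at two of the points transfer to the third.\<close>

lemma convex_on_three_points:
  fixes f :: "real \<Rightarrow> real"
  assumes f: "convex_on UNIV f" and "a < b" "b < c"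
  shows "(c - a) * f b \<le> (c - b) * f a + (b - a) * f c"
proof -
  have "f b \<le> (f c - f a) / (c - a) * (b - a) + f a"
    using convex_onD_Icc'[of a c f b] convex_on_subset[OF f] assms by auto
  then show ?thesis
    using assms by (simp add: field_simps)
qed

lemma convex_on_diff_affine:
  fixes f :: "real \<Rightarrow> real"
  assumes "convex_on UNIV f"
  shows "convex_on UNIV (\<lambda>x. f x - (a + b * x))"
proof (rule convex_onI)
  fix r x y :: real
  assume "0 < r" "r < 1"
  then show "f ((1 - r) *\<^sub>R x + r *\<^sub>R y) - (a + b * ((1 - r) *\<^sub>R x + r *\<^sub>R y))
      \<le> (1 - r) * (f x - (a + b * x)) + r * (f y - (a + b * y))"
    using convex_onD[OF assms, of r x y] by (simp add: algebra_simps)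
qed simp

lemma convex_on_UNIV_continuous:
  fixes f :: "real \<Rightarrow> real"
  assumes "convex_on UNIV f"
  shows "continuous_on UNIV f"
  using convex_on_continuous[OF open_UNIV assms] .

section \<open>Moments\<close>

text \<open>A supporting line of \<open>d\<close> at \<open>\<mu>\<close> bounds the attainable set from below (Jensen's inequality).
  An interior point can be lowered a little within the set, so it is strictly above that line.\<close>

lemma interior_attainable_above_graph:
  assumes d: "convex_on UNIV d" and int: "(\<mu>, \<sigma>) \<in> interior (attainable_moments d)"
  shows "d \<mu> < \<sigma>"
proof -
  obtain s where s: "\<And>y. d \<mu> + s * (y - \<mu>) \<le> d y"
    using convex_on_subgradient[OF d] by blast
  have above: "d \<mu> + s * (m - \<mu>) \<le> v" if "(m, v) \<in> attainable_moments d" for m v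
  proof -
    obtain P where P: "real_distribution P" "integrable P (\<lambda>x. x)" "integrable P d"
      and mv: "m = integral\<^sup>L P (\<lambda>x. x)" "v = integral\<^sup>L P d"
      using \<open>(m, v) \<in> attainable_moments d\<close>
      by (auto simp: attainable_moments_def finite_moment_distrs_def)
    interpret real_distribution P by fact
    have "d \<mu> + s * (m - \<mu>) = (\<integral>x. d \<mu> + s * (x - \<mu>) \<partial>P)"
      using P prob_space by (simp add: mv)
    also have "\<dots> \<le> v"
      unfolding mv using P s by (intro integral_mono) auto
    finally show ?thesis .
  qed
  obtain e where e: "e > 0" "ball (\<mu>, \<sigma>) e \<subseteq> attainable_moments d"
    using int by (auto simp: mem_interior)
  have "(\<mu>, \<sigma> - e / 2) \<in> ball (\<mu>, \<sigma>) e"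
    using e by (simp add: dist_Pair_Pair dist_real_def)
  then show ?thesis
    using above[of \<mu> "\<sigma> - e / 2"] e by auto
qed

text \<open>Weak duality: \<open>h\<close> is a majorant of the function that is \<open>s * (x - b)\<close> on \<open>{t..}\<close> and \<open>0\<close> to
  the left of \<open>t\<close>, so its nonpositive mean forces \<open>E[(X - b) 1{X \<ge> t}] \<le> 0\<close>.\<close>

lemma cond_expectation_ge_le:
  assumes P: "real_distribution P" "integrable P (\<lambda>x. x)" "integrable P h"
    and mean: "integral\<^sup>L P h \<le> 0"
    and left: "\<And>x. x < t \<Longrightarrow> 0 \<le> h x"
    and right: "\<And>x. t \<le> x \<Longrightarrow> s * (x - b) \<le> h x"
    and "s > 0" and pos: "measure P {t..} > 0"
  shows "cond_expectation_ge P t \<le> b"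
proof -
  interpret real_distribution P by fact
  have [simp]: "integrable P (\<lambda>x. x * indicator {t..} x)"
    using integrable_real_mult_indicator[of "{t..}" P "\<lambda>x. x"] P(2) by simp
  have [simp]: "integrable P (\<lambda>x. indicator {t..} x :: real)"
    using integrable_real_mult_indicator[of "{t..}" P "\<lambda>x. 1"] by simp
  have "s * ((\<integral>x. x * indicator {t..} x \<partial>P) - b * measure P {t..})
      = (\<integral>x. s * (x * indicator {t..} x - b * indicator {t..} x) \<partial>P)"
    by simp
  also have "\<dots> \<le> integral\<^sup>L P h"
  proof (rule integral_mono)
    fix x
    show "s * (x * indicator {t..} x - b * indicator {t..} x) \<le> h x"
      using left[of x] right[of x] by (cases "t \<le> x") (auto simp: indicator_def)
  qed (use P in auto)
  finally have "(\<integral>x. x * indicator {t..} x \<partial>P) \<le> b * measure P {t..}"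
    using mean mult_pos_pos[OF \<open>s > 0\<close>] by (smt (verit))
  then show ?thesis
    using pos by (simp add: cond_expectation_ge_def divide_le_eq)
qed

text \<open>The assumption \<open>collinear\<close> says that \<open>(\<mu>, \<sigma>)\<close> is on the segment from \<open>(u, d u)\<close> to
  \<open>(y, d y)\<close>, so the weights that give mean \<open>\<mu>\<close> also give \<open>E[d(X)] = \<sigma>\<close>. As \<open>u < t \<le> y\<close>,
  conditioning on \<open>{t..}\<close> leaves only the atom \<open>y\<close>.\<close>

lemma two_point_distribution:
  assumes d: "d \<in> borel_measurable borel"
    and u: "u < t" "t \<le> y" "u < \<mu>" "\<mu> < y"
    and collinear: "(y - \<mu>) * d u + (\<mu> - u) * d y = (y - u) * \<sigma>"
  obtains P where "P \<in> ambiguity_set d \<mu> \<sigma>" "measure P {t..} > 0"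
    "cond_expectation_ge P t = y"
proof -
  define w where "w = (y - \<mu>) / (y - u)"
  have w: "0 \<le> w" "w \<le> 1" "w < 1"
    using u by (auto simp: w_def field_simps)
  (* The two-point law is realised as the image on the Borel space of a coin with bias w. *)
  define B where "B = measure_pmf (bernoulli_pmf w)"
  define X where "X = (\<lambda>b. if b then u else y)"
  define P where "P = distr B borel X"
  have X: "X \<in> B \<rightarrow>\<^sub>M borel"
    by (simp add: B_def)
  interpret real_distribution P
    unfolding P_def by (rule prob_space.real_distribution_distr) (simp_all add: B_def prob_space_measure_pmf)
  have integrable: "integrable P f" if "f \<in> borel_measurable borel" for f :: "real \<Rightarrow> real"
    unfolding P_def integrable_distr_eq[OF X that]
    unfolding B_def by (rule integrable_measure_pmf_finite) simp
  have integral: "integral\<^sup>L P f = w * f u + (1 - w) * f y"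
    if "f \<in> borel_measurable borel" for f :: "real \<Rightarrow> real"
    unfolding P_def integral_distr[OF X that]
    using w by (simp add: B_def X_def)
  have w1: "1 - w = (\<mu> - u) / (y - u)"
    using u by (simp add: w_def field_simps)
  have "w * u + (1 - w) * y = ((y - \<mu>) * u + (\<mu> - u) * y) / (y - u)"
    unfolding w1 by (simp add: w_def add_divide_distrib)
  also have "\<dots> = \<mu>"
    using u by (simp add: divide_eq_eq) (simp add: algebra_simps)
  finally have mean: "w * u + (1 - w) * y = \<mu>" .
  have "w * d u + (1 - w) * d y = ((y - \<mu>) * d u + (\<mu> - u) * d y) / (y - u)"
    unfolding w1 by (simp add: w_def add_divide_distrib)
  also have "\<dots> = \<sigma>"
    using u by (simp add: collinear)
  finally have weights: "w * u + (1 - w) * y = \<mu>" "w * d u + (1 - w) * d y = \<sigma>"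
    using mean by auto
  have "integral\<^sup>L P (\<lambda>x. x) = \<mu>" "integral\<^sup>L P d = \<sigma>"
    using integral[of "\<lambda>x. x"] integral[OF d] weights by auto
  then have mem: "P \<in> ambiguity_set d \<mu> \<sigma>"
    using integrable[OF d] integrable[of "\<lambda>x. x"] real_distribution_axioms
    by (simp add: ambiguity_set_def finite_moment_distrs_def)
  have tail: "measure P {t..} = 1 - w"
    using integral[of "indicator {t..}"] u by simp
  have "(\<integral>x. x * indicator {t..} x \<partial>P) = (1 - w) * y"
    using u by (subst integral) (simp_all)
  then have "cond_expectation_ge P t = y"
    using w by (simp add: cond_expectation_ge_def tail)
  with mem tail w show ?thesis
    by (intro that) auto
qed

section \<open>The sharp bound\<close>

text \<open>For \<open>u < \<mu> < y\<close>, the quantity \<open>(y - \<mu>) * h u + (\<mu> - u) * h y\<close> has the sign of the height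
  over \<open>\<mu>\<close> of the chord of \<open>h\<close> between \<open>u\<close> and \<open>y\<close>. At \<open>u = t\<close>, \<open>y = c\<close> it is negative, and it
  stays so for \<open>u\<close> slightly less than \<open>t\<close>. At \<open>y = b\<close> it is nonnegative for all \<open>u < t\<close>, since
  \<open>h u \<ge> 0\<close>. So, with \<open>u\<close> fixed near \<open>t\<close>, it vanishes for some \<open>y\<close> between \<open>c\<close> and \<open>b\<close>.\<close>

lemma chord_through_nearby_point:
  fixes h :: "real \<Rightarrow> real"
  assumes h: "convex_on UNIV h"
    and order: "t < \<mu>" "\<mu> < b"
    and zero: "h t = 0" "h b = 0" and neg: "h \<mu> < 0"
    and c: "\<mu> < c" "c < b"
  obtains u y where "u < t" "c \<le> y" "(y - \<mu>) * h u + (\<mu> - u) * h y = 0"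
proof -
  have cont: "continuous_on UNIV h"
    using convex_on_UNIV_continuous[OF h] .
  define G where "G u y = (y - \<mu>) * h u + (\<mu> - u) * h y" for u y
  have "(b - \<mu>) * h c \<le> (b - c) * h \<mu>"
    using convex_on_three_points[OF h c] zero by simp
  also have "\<dots> < 0"
    using c neg by (simp add: mult_less_0_iff)
  finally have "h c < 0"
    using order by (simp add: mult_less_0_iff)
  then have "G t c < 0"
    using order zero by (simp add: G_def mult_less_0_iff)
  have "isCont h t"
    using cont by (simp add: continuous_on_eq_continuous_at)
  then have "isCont (\<lambda>u. G u c) t"
    unfolding G_def by (intro continuous_intros)
  then have "((\<lambda>u. G u c) \<longlongrightarrow> G t c) (at_left t)"
    by (auto simp: isCont_def intro: tendsto_within_subset)
  then have "\<forall>\<^sub>F u in at_left t. G u c < 0"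
    using \<open>G t c < 0\<close> by (rule order_tendstoD)
  moreover have "\<forall>\<^sub>F u in at_left t. u < t"
    by (simp add: eventually_at_filter)
  ultimately have "\<forall>\<^sub>F u in at_left t. G u c < 0 \<and> u < t"
    by eventually_elim simp
  then obtain u where u: "G u c < 0" "u < t"
    using eventually_happens'[OF trivial_limit_at_left_real] by blast
  have "0 \<le> (t - u) * (- h \<mu>)"
    using u neg by (intro mult_nonneg_nonneg) auto
  also have "\<dots> \<le> (\<mu> - t) * h u"
    using convex_on_three_points[OF h \<open>u < t\<close> \<open>t < \<mu>\<close>] zero by simp
  finally have "0 \<le> h u"
    using order by (simp add: zero_le_mult_iff)
  then have "0 \<le> G u b"
    using order zero by (simp add: G_def)
  have "continuous_on {c..b} (G u)"
    unfolding G_def by (intro continuous_intros continuous_on_subset[OF cont]) auto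
  then obtain y where "c \<le> y" "G u y = 0"
    using IVT'[of "G u" c 0 b] u \<open>0 \<le> G u b\<close> c by auto
  then show ?thesis
    using u that[of u y] by (simp add: G_def)
qed

theorem proposition3:
  fixes d :: "real \<Rightarrow> real" and \<mu> \<sigma> t x\<^sub>0 :: real
  assumes "convex_on UNIV d"
    and "(\<mu>, \<sigma>) \<in> interior (attainable_moments d)"
    and "x\<^sub>0 \<in> {t<..}"
    and "t * d x\<^sub>0 - x\<^sub>0 * d t \<noteq> 0"
    and "(\<sigma> * t - \<mu> * d t) / (t * d x\<^sub>0 - x\<^sub>0 * d t)
       + (\<mu> * d x\<^sub>0 - \<sigma> * x\<^sub>0) / (t * d x\<^sub>0 - x\<^sub>0 * d t) = 1"
    and "two_point_feasible d \<mu> \<sigma> t x\<^sub>0"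
  shows "(SUP P \<in> {P \<in> ambiguity_set d \<mu> \<sigma>. measure P {t..} > 0}. ereal (cond_expectation_ge P t))
       = ereal x\<^sub>0"
proof -
  note d = \<open>convex_on UNIV d\<close>
  have "t < x\<^sub>0" using assms(3) by simp
  define \<beta> where "\<beta> = (d x\<^sub>0 - d t) / (x\<^sub>0 - t)"
  define \<alpha> where "\<alpha> = d t - \<beta> * t"
  define h where "h x = d x - (\<alpha> + \<beta> * x)" for x
  have h: "convex_on UNIV h"
    unfolding h_def using convex_on_diff_affine[OF d] .
  have "\<beta> * (x\<^sub>0 - t) = d x\<^sub>0 - d t"
    using \<open>t < x\<^sub>0\<close> by (simp add: \<beta>_def)
  then have zero: "h t = 0" "h x\<^sub>0 = 0"
    by (simp_all add: h_def \<alpha>_def algebra_simps)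
  obtain p :: "real pmf" where p: "set_pmf p \<subseteq> {t, x\<^sub>0}"
    "pmf p t * t + pmf p x\<^sub>0 * x\<^sub>0 = \<mu>" "pmf p t * d t + pmf p x\<^sub>0 * d x\<^sub>0 = \<sigma>"
    using assms(6) by (auto simp: two_point_feasible_def)
  have total: "pmf p t = 1 - pmf p x\<^sub>0"
    using sum_pmf_eq_1[of "{t, x\<^sub>0}" p] p(1) \<open>t < x\<^sub>0\<close> by simp
  have \<sigma>: "\<sigma> = \<alpha> + \<beta> * \<mu>"
  proof -
    have "d t = \<alpha> + \<beta> * t" "d x\<^sub>0 = \<alpha> + \<beta> * x\<^sub>0"
      using zero by (simp_all add: h_def)
    then show ?thesis
      unfolding p(2,3)[symmetric] total by (simp add: algebra_simps)
  qed
  (* This excludes a one-point distribution at t or x0, and d being affine between t and x0. *)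
  have neg: "h \<mu> < 0"
    using interior_attainable_above_graph[OF d assms(2)] by (simp add: h_def \<sigma>)
  have \<mu>: "\<mu> = t + pmf p x\<^sub>0 * (x\<^sub>0 - t)"
    using p(2) by (simp add: total algebra_simps)
  have "t \<le> \<mu>"
    using \<open>t < x\<^sub>0\<close> by (simp add: \<mu>)
  moreover have "pmf p x\<^sub>0 * (x\<^sub>0 - t) \<le> x\<^sub>0 - t"
    using \<open>t < x\<^sub>0\<close> by (intro mult_left_le_one_le pmf_le_1) auto
  then have "\<mu> \<le> x\<^sub>0"
    using \<mu> by linarith
  moreover have "\<mu> \<noteq> t" "\<mu> \<noteq> x\<^sub>0"
    using neg zero by auto
  ultimately have order: "t < \<mu>" "\<mu> < x\<^sub>0"
    by auto
  show ?thesis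
  proof (rule SUP_eqI)
    fix P
    assume P: "P \<in> {P \<in> ambiguity_set d \<mu> \<sigma>. measure P {t..} > 0}"
    then have int: "real_distribution P" "integrable P (\<lambda>x. x)" "integrable P d"
      and moments: "integral\<^sup>L P (\<lambda>x. x) = \<mu>" "integral\<^sup>L P d = \<sigma>"
      by (auto simp: ambiguity_set_def finite_moment_distrs_def)
    interpret real_distribution P by fact
    obtain s where s: "\<And>x. s * (x - x\<^sub>0) \<le> h x"
      using convex_on_subgradient[OF h, of x\<^sub>0] zero by auto
    have "s * (\<mu> - x\<^sub>0) < 0"
      using s[of \<mu>] neg by simp
    then have "s > 0"
      using order by (simp add: mult_less_0_iff)
    have left: "0 \<le> h x" if "x < t" for x
    proof -
      have "0 \<le> (t - x) * (- h \<mu>)"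
        using that neg by (intro mult_nonneg_nonneg) auto
      also have "\<dots> \<le> (\<mu> - t) * h x"
        using convex_on_three_points[OF h that \<open>t < \<mu>\<close>] zero by simp
      finally show ?thesis
        using order by (simp add: zero_le_mult_iff)
    qed
    have h_eq: "h = (\<lambda>x. d x - (\<alpha> + \<beta> * x))"
      by (simp add: h_def fun_eq_iff)
    have "prob UNIV = 1"
      using prob_space by simp
    then have "integral\<^sup>L P h = 0"
      unfolding h_eq using int moments by (simp add: \<sigma>)
    moreover have "integrable P h"
      unfolding h_eq using int by simp
    ultimately have "cond_expectation_ge P t \<le> x\<^sub>0"
      using P by (intro cond_expectation_ge_le[OF int(1,2) _ _ left s \<open>s > 0\<close>]) simp_all
    then show "ereal (cond_expectation_ge P t) \<le> ereal x\<^sub>0"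
      by simp
  next
    fix z :: ereal
    assume z: "\<And>P. P \<in> {P \<in> ambiguity_set d \<mu> \<sigma>. measure P {t..} > 0}
      \<Longrightarrow> ereal (cond_expectation_ge P t) \<le> z"
    have "ereal c \<le> z" if c: "\<mu> < c" "c < x\<^sub>0" for c
    proof -
      obtain u y where uy: "u < t" "c \<le> y" and eq: "(y - \<mu>) * h u + (\<mu> - u) * h y = 0"
        using chord_through_nearby_point[OF h order zero neg c] .
      have "(y - \<mu>) * d u + (\<mu> - u) * d y = (y - u) * \<sigma>"
        using eq by (simp add: h_def \<sigma> algebra_simps)
      moreover have "d \<in> borel_measurable borel"
        using convex_on_UNIV_continuous[OF d] by (rule borel_measurable_continuous_onI)
      ultimately obtain P where "P \<in> ambiguity_set d \<mu> \<sigma>" "measure P {t..} > 0"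
        "cond_expectation_ge P t = y"
        using two_point_distribution[of d u t y \<mu> \<sigma>] uy c order
        by (metis less_le_trans less_trans less_imp_le)
      then have "ereal y \<le> z"
        using z[of P] by simp
      then show ?thesis
        using order_trans[of "ereal c" "ereal y" z] uy(2) by simp
    qed
    then have below: "w \<le> z" if "ereal \<mu> < w" "w < ereal x\<^sub>0" for w
      using that by (cases w) simp_all
    show "ereal x\<^sub>0 \<le> z"
    proof (rule dense_le_bounded)
      show "ereal \<mu> < ereal x\<^sub>0"
        using order by simp
    qed (rule below)
  qed
qed

end
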